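(* Let $n$ be a positive integer and let $p(n)$ denote the number of unrestricted partitions of $n$. Then $$p(n)=\sum_{m=1}^{n^2-1}|\mathbb{B}(m)|+1.$$
   Context: For a positive integer $m$, let $\mathbb{A}(m)$ be the set of all tuples $(c_1,\ldots,c_b)$ of non-negative integers with $c_1\ge c_2\ge\cdots\ge c_b\ge 0$ that solve the system $b=x_1+\cdots+x_b$, $a=x_1^2+\cdots+x_b^2$ for some pair of non-negative integers $(a,b)$ with $a\equiv b\pmod 2$ and $m=b^2+2a$. For the fixed $n$, $\mathbb{B}(m)$ is the subset of $\mathbb{A}(m)$ consisting of those solutions $(c_1,\ldots,c_b)$ with $b+c_1\le n$. *)

theory Defs
  imports "HOL-Library.Multiset" "HOL-Number_Theory.Cong"
begin

definition partitions :: "nat \<Rightarrow> nat multiset set" where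
  "partitions n = {N. (\<forall>k \<in># N. 0 < k) \<and> sum_mset N = n}"

definition partition_number :: "nat \<Rightarrow> nat" where
  "partition_number n = card (partitions n)"

(* A tuple (c_1, ..., c_b) is a list of length b, weakly decreasing. *)
definition solutions :: "nat \<Rightarrow> nat \<Rightarrow> nat list set" where
  "solutions a b =
    {c. length c = b \<and> sorted_wrt (\<ge>) c \<and>
        b = sum_list c \<and> a = (\<Sum>x\<leftarrow>c. x ^ 2)}"

definition A_set :: "nat \<Rightarrow> nat list set" where
  "A_set m =
    {c. \<exists>a b. [a = b] (mod 2) \<and> m = b ^ 2 + 2 * a \<and> c \<in> solutions a b}"

(* b is recovered as length c, and c_1 as hd c.  For m > 0 the list is nonempty,
   since b = 0 forces a = 0 and hence m = 0; so hd is never applied to [] there. *)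
definition B_set :: "nat \<Rightarrow> nat \<Rightarrow> nat list set" where
  "B_set n m = {c \<in> A_set m. length c + hd c \<le> n}"

end

theory Submission
  imports Defs
begin

text \<open>
  Removing a largest part \<open>n - b\<close> from a partition of \<open>n\<close> leaves a partition of \<open>b\<close> whose
  parts are at most \<open>n - b\<close>; padded with zeros to length \<open>b\<close>, it is a weakly decreasing tuple with
  \<open>b + c\<^sub>1 \<le> n\<close>, and the empty tuple corresponds to the partition with the single part \<open>n\<close>.
  The value \<open>m = b\<^sup>2 + 2a\<close> is determined by the tuple, the parity condition is automatic because
  \<open>x\<^sup>2 \<equiv> x\<close> modulo 2, and \<open>a \<le> b c\<^sub>1 \<le> b (n - b)\<close> gives
  \<open>m \<le> n\<^sup>2 - (n - b)\<^sup>2 < n\<^sup>2\<close>, so the sum counts every nonempty tuple exactly once.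
\<close>

text \<open>The bound is imposed on every entry rather than on \<open>hd c\<close>, so that it makes
  sense for \<open>[]\<close>; \<open>length c < n\<close> keeps the part
  \<open>n - length c\<close> positive.\<close>

definition padded_partitions :: "nat \<Rightarrow> nat list set" where
  "padded_partitions n = {c. sorted_wrt (\<ge>) c \<and> length c = sum_list c \<and>
     length c < n \<and> (\<forall>x\<in>set c. length c + x \<le> n)}"

definition attach_largest_part :: "nat \<Rightarrow> nat list \<Rightarrow> nat multiset" where
  "attach_largest_part n c = add_mset (n - length c) (filter_mset (\<lambda>x. 0 < x) (mset c))"

lemma sum_list_squares_cong: "[(\<Sum>x\<leftarrow>c. x ^ 2) = sum_list c] (mod 2)" for c :: "nat list"
proof (induction c)
  case (Cons x c)
  have "[x ^ 2 = x] (mod 2)"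
    by (simp add: cong_def mod2_eq_if)
  with Cons show ?case
    by (simp add: cong_add)
qed simp

lemma sum_list_squares_le:
  fixes c :: "nat list"
  assumes "\<And>x. x \<in> set c \<Longrightarrow> x \<le> k"
  shows "(\<Sum>x\<leftarrow>c. x ^ 2) \<le> k * sum_list c"
  using assms
proof (induction c)
  case (Cons x c)
  have "x ^ 2 \<le> k * x"
    using Cons.prems by (simp add: power2_eq_square)
  moreover have "(\<Sum>x\<leftarrow>c. x ^ 2) \<le> k * sum_list c"
    using Cons by simp
  ultimately show ?case
    by (simp add: distrib_left)
qed simp

lemma size_le_sum_mset:
  fixes M :: "nat multiset"
  assumes "\<And>k. k \<in># M \<Longrightarrow> 0 < k"
  shows "size M \<le> sum_mset M"
  using assms
proof (induction M)
  case (add x M)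
  then have "size M \<le> sum_mset M" "0 < x"
    by auto
  then show ?case
    by simp
qed simp

lemma sum_mset_filter_pos: "sum_mset (filter_mset (\<lambda>x. 0 < x) M) = sum_mset M"
  for M :: "nat multiset"
  by (induction M) auto

text \<open>Thus the size and the positive elements determine a multiset, which is what allows the
  zero padding to be undone.\<close>

lemma mset_eq_filter_pos_plus_zeros:
  fixes M :: "nat multiset"
  shows "M = filter_mset (\<lambda>x. 0 < x) M + replicate_mset (size M - size (filter_mset (\<lambda>x. 0 < x) M)) 0"
proof (induction M)
  case (add x M)
  have "size (filter_mset (\<lambda>x. 0 < x) M) \<le> size M"
    by (rule size_filter_mset_lesseq)
  with add show ?case
    by (auto simp: Suc_diff_le)
qed simp

text \<open>Reversal turns both lists into ascending ones, and these are the unique sorted list of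
  their multiset.\<close>

lemma sorted_wrt_ge_mset_unique:
  fixes c d :: "nat list"
  assumes "sorted_wrt (\<ge>) c" "sorted_wrt (\<ge>) d" "mset c = mset d"
  shows "c = d"
proof -
  have "sorted (rev c)" "sorted (rev d)"
    using assms by (simp_all add: sorted_wrt_rev)
  moreover have "mset (rev c) = mset (rev d)"
    using assms by simp
  ultimately have "rev c = rev d"
    by (metis properties_for_sort)
  then show ?thesis
    by simp
qed

lemma finite_padded_partitions: "finite (padded_partitions n)"
proof (rule finite_subset)
  show "padded_partitions n \<subseteq> {c. set c \<subseteq> {..n} \<and> length c \<le> n}"
    by (force simp: padded_partitions_def)
qed (simp add: finite_lists_length_le)

text \<open>No entry exceeds \<open>n - length c\<close>, so the attached part is a maximum; the
  length of the tuple can therefore be read off its image.\<close>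

lemma Max_attach_largest_part:
  assumes "c \<in> padded_partitions n"
  shows "Max_mset (attach_largest_part n c) = n - length c"
  using assms
  by (intro Max_eqI) (force simp: padded_partitions_def attach_largest_part_def)+

lemma inj_on_attach_largest_part: "inj_on (attach_largest_part n) (padded_partitions n)"
proof (rule inj_onI)
  fix c d
  assume c: "c \<in> padded_partitions n" and d: "d \<in> padded_partitions n"
    and eq: "attach_largest_part n c = attach_largest_part n d"
  have "n - length c = n - length d"
    using Max_attach_largest_part[OF c] Max_attach_largest_part[OF d] eq by simp
  \<comment> \<open>Both lengths are below \<open>n\<close>, so the truncated subtraction
    cancels.\<close>
  then have len: "length c = length d"
    using c d by (fastforce simp: padded_partitions_def)
  then have "filter_mset (\<lambda>x. 0 < x) (mset c) = filter_mset (\<lambda>x. 0 < x) (mset d)"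
    using eq by (simp add: attach_largest_part_def)
  then have "mset c = mset d"
    using len mset_eq_filter_pos_plus_zeros[of "mset c"] mset_eq_filter_pos_plus_zeros[of "mset d"]
    by simp
  then show "c = d"
    using c d by (auto simp: padded_partitions_def intro: sorted_wrt_ge_mset_unique)
qed

text \<open>The entries of \<open>c\<close> sum to \<open>length c\<close>, which together with
  \<open>n - length c\<close> gives \<open>n\<close>.\<close>

lemma attach_largest_part_in_partitions:
  assumes "c \<in> padded_partitions n"
  shows "attach_largest_part n c \<in> partitions n"
  using assms
  by (auto simp: padded_partitions_def attach_largest_part_def partitions_def
      sum_mset_filter_pos sum_mset_sum_list simp del: mset_filter)

lemma partition_in_image_attach_largest_part:
  assumes "n > 0" and M: "M \<in> partitions n"
  shows "M \<in> attach_largest_part n ` padded_partitions n"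
proof -
  have pos: "\<And>k. k \<in># M \<Longrightarrow> 0 < k" and sum: "sum_mset M = n"
    using M by (auto simp: partitions_def)
  have "M \<noteq> {#}"
    using sum \<open>n > 0\<close> by auto
  define k where "k = Max_mset M"
  have kM: "k \<in># M"
    using \<open>M \<noteq> {#}\<close> by (simp add: k_def)
  have k_max: "x \<le> k" if "x \<in># M" for x
    using that by (simp add: k_def)
  define N where "N = M - {#k#}"
  have MN: "M = add_mset k N"
    using kM by (simp add: N_def)
  have k_sum: "k + sum_mset N = n" and "0 < k"
    using sum pos MN by auto
  have size_N: "size N \<le> sum_mset N"
    using pos MN by (intro size_le_sum_mset) auto
  have filter_N: "filter_mset (\<lambda>x. 0 < x) N = N"
    using pos MN by (simp add: filter_mset_eq_conv)
  \<comment> \<open>By \<open>size_N\<close> the difference is not truncated: exactly enough zeros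
    are added to bring the size up to \<open>sum_mset N\<close>.\<close>
  define P where "P = N + replicate_mset (sum_mset N - size N) 0"
  define c where "c = rev (sorted_list_of_multiset P)"
  have mset_c: "mset c = P"
    by (simp add: c_def)
  have len: "length c = sum_mset N"
    using size_N mset_c by (metis P_def le_add_diff_inverse size_mset size_replicate_mset size_union)
  have "sum_list c = sum_mset N"
    using mset_c by (simp add: P_def flip: sum_mset_sum_list)
  moreover have "sorted_wrt (\<ge>) c"
    by (simp add: c_def sorted_wrt_rev)
  moreover have "sum_mset N + x \<le> n" if "x \<in> set c" for x
  proof -
    have "x \<in># P"
      using that mset_c by (metis set_mset_mset)
    then have "x \<in># N \<or> x = 0"
      by (auto simp: P_def split: if_splits)
    then have "x \<le> k"
      using k_max MN by auto
    then show ?thesis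
      using k_sum by simp
  qed
  ultimately have "c \<in> padded_partitions n"
    using len k_sum \<open>0 < k\<close> by (auto simp: padded_partitions_def)
  moreover have "attach_largest_part n c = M"
  proof -
    have "filter_mset (\<lambda>x. 0 < x) (mset c) = N"
      unfolding mset_c P_def by (simp add: filter_N filter_mset_eq_conv)
    moreover have "n - length c = k"
      using len k_sum by simp
    ultimately show ?thesis
      unfolding attach_largest_part_def using MN by simp
  qed
  ultimately show ?thesis
    by blast
qed

lemma card_padded_partitions:
  assumes "n > 0"
  shows "card (padded_partitions n) = partition_number n"
proof -
  have "attach_largest_part n ` padded_partitions n = partitions n"
    using attach_largest_part_in_partitions partition_in_image_attach_largest_part[OF assms]
    by auto
  then show ?thesis
    unfolding partition_number_def using inj_on_attach_largest_part card_image by metis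
qed

lemma padded_partition_weight_less:
  assumes "c \<in> padded_partitions n"
  shows "(length c)\<^sup>2 + 2 * (\<Sum>x\<leftarrow>c. x ^ 2) < n\<^sup>2"
proof -
  define b where "b = length c"
  have b: "b < n" "sum_list c = b" "\<And>x. x \<in> set c \<Longrightarrow> x \<le> n - b"
    using assms by (force simp: padded_partitions_def b_def)+
  obtain d where d: "n = b + d" "0 < d"
    using b(1) by (metis less_imp_add_positive)
  have "(\<Sum>x\<leftarrow>c. x ^ 2) \<le> (n - b) * b"
    using sum_list_squares_le[of c "n - b"] b by simp
  then have "b\<^sup>2 + 2 * (\<Sum>x\<leftarrow>c. x ^ 2) \<le> b\<^sup>2 + 2 * (d * b)"
    using d by simp
  \<comment> \<open>With \<open>n = b + d\<close> the two sides differ by the square of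
    \<open>d\<close>, which is positive.\<close>
  also have "\<dots> < n\<^sup>2"
    using d by (simp add: power2_eq_square algebra_simps)
  finally show ?thesis
    by (simp add: b_def)
qed

text \<open>Positive \<open>m\<close> excludes \<open>[]\<close>, whose head is unspecified; on a
  nonempty descending list, bounding the head bounds every entry.\<close>

lemma B_set_eq:
  assumes "m > 0"
  shows "B_set n m =
    {c \<in> padded_partitions n. (length c)\<^sup>2 + 2 * (\<Sum>x\<leftarrow>c. x ^ 2) = m}"
proof (rule set_eqI, rule iffI)
  fix c
  assume "c \<in> B_set n m"
  then have c: "sorted_wrt (\<ge>) c" "length c = sum_list c" "length c + hd c \<le> n"
    and m: "(length c)\<^sup>2 + 2 * (\<Sum>x\<leftarrow>c. x ^ 2) = m"
    by (auto simp: B_set_def A_set_def solutions_def)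
  have "c \<noteq> []"
    using m assms by auto
  then have le_hd: "x \<le> hd c" if "x \<in> set c" for x
    using that c(1) by (cases c) auto
  \<comment> \<open>A positive head turns \<open>length c + hd c \<le> n\<close> into the strict
    bound \<open>length c < n\<close>.\<close>
  have "hd c \<noteq> 0"
  proof
    assume "hd c = 0"
    then have "sum_list c = 0"
      using le_hd by auto
    then show False
      using c(2) \<open>c \<noteq> []\<close> by (metis length_0_conv)
  qed
  then have "c \<in> padded_partitions n"
    using c le_hd by (force simp: padded_partitions_def)
  with m show "c \<in> {c \<in> padded_partitions n. (length c)\<^sup>2 + 2 * (\<Sum>x\<leftarrow>c. x ^ 2) = m}"
    by simp
next
  fix c
  assume "c \<in> {c \<in> padded_partitions n. (length c)\<^sup>2 + 2 * (\<Sum>x\<leftarrow>c. x ^ 2) = m}"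
  then have c: "c \<in> padded_partitions n" and m: "(length c)\<^sup>2 + 2 * (\<Sum>x\<leftarrow>c. x ^ 2) = m"
    by auto
  have "c \<noteq> []"
    using m assms by auto
  then have "length c + hd c \<le> n"
    using c hd_in_set unfolding padded_partitions_def by blast
  moreover have "[(\<Sum>x\<leftarrow>c. x ^ 2) = length c] (mod 2)"
    using c sum_list_squares_cong[of c] by (simp add: padded_partitions_def)
  then have "c \<in> A_set m"
    using c m unfolding A_set_def solutions_def padded_partitions_def by blast
  ultimately show "c \<in> B_set n m"
    by (simp add: B_set_def)
qed

theorem mainTheorem9:
  fixes n :: nat
  assumes "n > 0"
  shows "partition_number n = (\<Sum>m = 1..n\<^sup>2 - 1. card (B_set n m)) + 1"
proof -
  define w where "w c = (length c)\<^sup>2 + 2 * (\<Sum>x\<leftarrow>c. x ^ 2)" for c :: "nat list"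
  have B: "B_set n m = {c \<in> padded_partitions n. w c = m}" if "m \<in> {1..n\<^sup>2 - 1}" for m
    using that B_set_eq[of m n] by (simp add: w_def)
  have "w c \<in> {1..n\<^sup>2 - 1}" if "c \<in> padded_partitions n" "c \<noteq> []" for c
    using padded_partition_weight_less[OF that(1)] that(2)
    by (auto simp: w_def Suc_le_eq)
  moreover have "w [] = 0"
    by (simp add: w_def)
  ultimately have U: "padded_partitions n - {[]} = (\<Union>m\<in>{1..n\<^sup>2 - 1}. B_set n m)"
    using B by fastforce
  \<comment> \<open>The sets \<open>B_set n m\<close> in this range are fibres of \<open>w\<close>,
    hence pairwise disjoint.\<close>
  have "card (padded_partitions n - {[]}) = (\<Sum>m = 1..n\<^sup>2 - 1. card (B_set n m))"
    unfolding U using finite_padded_partitions[of n] B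
    by (intro card_UN_disjoint) auto
  \<comment> \<open>The empty tuple has weight 0, outside the range of summation, and supplies the
    summand 1.\<close>
  moreover have "[] \<in> padded_partitions n"
    using assms by (simp add: padded_partitions_def)
  then have "card (padded_partitions n) = card (padded_partitions n - {[]}) + 1"
    using finite_padded_partitions[of n] by (metis Suc_eq_plus1 card.remove)
  ultimately show ?thesis
    using card_padded_partitions[OF assms] by simp
qed

end
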